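(* Let $G$ be a finite simple graph with edge set $E = \{e_1,\ldots,e_q\}$ and suppose that $H$ is a subgraph of $G$ with edge set $E' = \{e_{i_1},\ldots,e_{i_r}\}$. Let $I_G \subseteq R = k[e_1,\ldots,e_q]$ be the toric ideal of $G$, and let $I_H \subseteq k[e_{i_1},\ldots,e_{i_r}]$ denote the toric ideal of $H$. If $I_H^e$ is the extension of $I_H$ in $R$, then $$\mathbb{V}(I_G) \star \mathbb{V}(I^e_H) = \mathbb{V}(I^e_H).$$
   Context: $k$ is an algebraically closed field of characteristic zero. For a homogeneous ideal $I$ of a standard graded polynomial ring in $q$ variables over $k$, $\mathbb{V}(I) \subseteq \mathbb{P}^{q-1}$ is the projective variety it defines. A finite simple graph $G=(V,E)$ has a finite vertex set $V$ and edge set $E \subseteq \{\{u,v\} \mid u,v\in V, u\neq v\}$; $H=(V_1,E_1)$ is a subgraph of $G$ if it is a finite simple graph with $V_1\subseteq V$ and $E_1 \subseteq E$. Toric ideal of a graph: if $G$ has vertices $v_1,\ldots,v_n$ and edges $e_1,\ldots,e_q$, then $I_G$ is the kernel of the $k$-algebra homomorphism $\varphi: k[e_1,\ldots,e_q]\to k[v_1,\ldots,v_n]$ given by $\varphi(e_i) = v_{i_1}v_{i_2}$ for $e_i = \{v_{i_1},v_{i_2}\}$, where edges and vertices are also used as names of variables. The extension $I_H^e$ is the ideal of $k[e_1,\ldots,e_q]$ generated by the image of $I_H$ under the natural inclusion $k[e_{i_1},\ldots,e_{i_r}] \hookrightarrow k[e_1,\ldots,e_q]$. Hadamard product: for points $p=[p_0:\cdots:p_N]$,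 $q=[q_0:\cdots:q_N]$ of $\mathbb{P}^N$, $p\star q := [p_0q_0:\cdots:p_Nq_N]$, which is defined when $p_iq_i \neq 0$ for at least one $i$. For projective varieties $X,Y \subseteq \mathbb{P}^N$, $X \star Y$ is the Zariski closure of $\{p\star q \mid p \in X, q\in Y, p\star q \text{ is defined}\}$. *)

theory Defs
  imports
    "HOL-Library.Poly_Mapping"
    "HOL-Library.FuncSet"
    "HOL-Computational_Algebra.Polynomial"
    "HOL-Algebra.RingHom"
    "HOL.Hull"
begin

section \<open>Finite simple graphs\<close>

definition finite_simple_graph :: "'v set \<Rightarrow> 'v set set \<Rightarrow> bool" where
  "finite_simple_graph V E \<longleftrightarrow> finite V \<and> E \<subseteq> {{u, v} | u v. u \<in> V \<and> v \<in> V \<and> u \<noteq> v}"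

definition subgraph_of :: "'v set \<Rightarrow> 'v set set \<Rightarrow> 'v set \<Rightarrow> 'v set set \<Rightarrow> bool" where
  "subgraph_of V1 E1 V E \<longleftrightarrow> finite_simple_graph V1 E1 \<and> V1 \<subseteq> V \<and> E1 \<subseteq> E"


section \<open>Polynomials in several variables\<close>

text \<open>
  A monomial is a finitely supported exponent function and a polynomial is a finitely supported
  coefficient function on monomials. The whole type consists of the polynomials in all elements
  of \<^typ>\<open>'x\<close> as variables; the ring $k[X]$ for a set \<open>X\<close> of variables is its subring
  \<open>poly_ring X\<close>. In particular, for \<open>Y \<subseteq> X\<close> the natural inclusion of $k[Y]$ in $k[X]$ is
  the inclusion of sets.
\<close>

type_synonym ('x, 'k) mpoly = "('x \<Rightarrow>\<^sub>0 nat) \<Rightarrow>\<^sub>0 'k"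

definition poly_ring :: "'x set \<Rightarrow> ('x, 'k::comm_ring_1) mpoly ring" where
  "poly_ring X = \<lparr>carrier = {p. \<forall>m\<in>Poly_Mapping.keys p. Poly_Mapping.keys m \<subseteq> X},
     mult = (*), one = 1, zero = 0, add = (+)\<rparr>"

definition Const :: "'k::comm_ring_1 \<Rightarrow> ('x, 'k) mpoly" where
  "Const c = Poly_Mapping.single 0 c"

definition Var :: "'x \<Rightarrow> ('x, 'k::comm_ring_1) mpoly" where
  "Var x = Poly_Mapping.single (Poly_Mapping.single x 1) 1"

text \<open>
  Substitution of \<open>g x\<close> for each variable \<open>x\<close>, the coefficients being mapped by \<open>c\<close>. With
  \<open>c = id\<close> this is evaluation at a point; with \<open>c = Const\<close> it is the algebra homomorphism
  into another polynomial ring that sends \<open>x\<close> to \<open>g x\<close>.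
\<close>

definition poly_subst ::
  "('k::comm_ring_1 \<Rightarrow> 'r::comm_ring_1) \<Rightarrow> ('x \<Rightarrow> 'r) \<Rightarrow> ('x, 'k) mpoly \<Rightarrow> 'r" where
  "poly_subst c g p =
     (\<Sum>m\<in>Poly_Mapping.keys p.
        c (Poly_Mapping.lookup p m) * (\<Prod>x\<in>Poly_Mapping.keys m. g x ^ Poly_Mapping.lookup m x))"

definition mono_degree :: "('x \<Rightarrow>\<^sub>0 nat) \<Rightarrow> nat" where
  "mono_degree m = (\<Sum>x\<in>Poly_Mapping.keys m. Poly_Mapping.lookup m x)"

definition homogeneous :: "('x, 'k::comm_ring_1) mpoly \<Rightarrow> bool" where
  "homogeneous p \<longleftrightarrow> (\<exists>d. \<forall>m\<in>Poly_Mapping.keys p. mono_degree m = d)"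

definition homogeneous_ideal :: "'x set \<Rightarrow> ('x, 'k::comm_ring_1) mpoly set \<Rightarrow> bool" where
  "homogeneous_ideal X J \<longleftrightarrow>
     (\<exists>S \<subseteq> carrier (poly_ring X). (\<forall>f\<in>S. homogeneous f) \<and> J = genideal (poly_ring X) S)"

lemma poly_subst_add:
  assumes "c 0 = 0" "\<And>a b. c (a + b) = c a + c b"
  shows "poly_subst c g (p + q) = poly_subst c g p + poly_subst c g q"
  unfolding poly_subst_def by (rule setsum_keys_plus_distrib) (simp_all add: assms ring_distribs)

lemma poly_subst_single:
  assumes "c 0 = 0"
  shows "poly_subst c g (Poly_Mapping.single m a) =
           c a * (\<Prod>x\<in>Poly_Mapping.keys m. g x ^ Poly_Mapping.lookup m x)"
  by (simp add: poly_subst_def assms)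

lemma prod_keys_add:
  fixes g :: "'x \<Rightarrow> 'r::comm_ring_1"
  shows "(\<Prod>x\<in>Poly_Mapping.keys (m + n). g x ^ Poly_Mapping.lookup (m + n) x) =
         (\<Prod>x\<in>Poly_Mapping.keys m. g x ^ Poly_Mapping.lookup m x) *
         (\<Prod>x\<in>Poly_Mapping.keys n. g x ^ Poly_Mapping.lookup n x)"
proof -
  let ?A = "Poly_Mapping.keys m \<union> Poly_Mapping.keys n"
  have ext: "(\<Prod>x\<in>Poly_Mapping.keys k. g x ^ Poly_Mapping.lookup k x) =
             (\<Prod>x\<in>?A. g x ^ Poly_Mapping.lookup k x)" if "Poly_Mapping.keys k \<subseteq> ?A" for k
    by (rule prod.mono_neutral_left) (use that in \<open>auto simp: in_keys_iff\<close>)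
  show ?thesis
    unfolding ext[OF keys_add[of m n]] ext[of m, OF Un_upper1] ext[of n, OF Un_upper2]
    by (simp add: lookup_add power_add prod.distrib)
qed

lemma mpoly_induct:
  assumes single: "\<And>m a. P (Poly_Mapping.single m a)"
    and add: "\<And>p q. P p \<Longrightarrow> P q \<Longrightarrow> P (p + q)"
  shows "P (p :: ('x, 'k::comm_ring_1) mpoly)"
proof (induction p rule: update_induct)
  case const
  show ?case using single[of 0 0] by simp
next
  case (update f a b)
  have "Poly_Mapping.update a b f = Poly_Mapping.single a b + f"
    using update(1)
    by (intro poly_mapping_eqI) (auto simp: lookup_update lookup_add lookup_single in_keys_iff)
  then show ?case using add[OF single update(3)] by metis
qed

lemma poly_subst_mult:
  assumes "c 0 = 0" "\<And>a b. c (a + b) = c a + c b" "\<And>a b. c (a * b) = c a * c b"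
  shows "poly_subst c g (p * q) = poly_subst c g p * poly_subst c g q"
proof (induction p rule: mpoly_induct)
  case (1 m a)
  show ?case
  proof (induction q rule: mpoly_induct)
    case (1 n b)
    show ?case
      by (simp add: mult_single poly_subst_single assms prod_keys_add mult_ac)
  next
    case (2 p q)
    then show ?case by (simp add: ring_distribs poly_subst_add assms)
  qed
next
  case (2 p q)
  then show ?case by (simp add: ring_distribs poly_subst_add assms)
qed

lemma poly_ring_simps [simp]:
  "\<one>\<^bsub>poly_ring X\<^esub> = 1" "\<zero>\<^bsub>poly_ring X\<^esub> = 0"
  "p \<otimes>\<^bsub>poly_ring X\<^esub> q = p * q" "p \<oplus>\<^bsub>poly_ring X\<^esub> q = p + q"
  by (simp_all add: poly_ring_def)

lemma poly_ring_carrier: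
  "p \<in> carrier (poly_ring X) \<longleftrightarrow> (\<forall>m\<in>Poly_Mapping.keys p. Poly_Mapping.keys m \<subseteq> X)"
  by (simp add: poly_ring_def)

lemma poly_ring_closed:
  "0 \<in> carrier (poly_ring X)" "1 \<in> carrier (poly_ring X)" "Const a \<in> carrier (poly_ring X)"
  "x \<in> X \<Longrightarrow> Var x \<in> carrier (poly_ring X)"
  "p \<in> carrier (poly_ring X) \<Longrightarrow> - p \<in> carrier (poly_ring X)"
  "p \<in> carrier (poly_ring X) \<Longrightarrow> q \<in> carrier (poly_ring X) \<Longrightarrow> p + q \<in> carrier (poly_ring X)"
  "p \<in> carrier (poly_ring X) \<Longrightarrow> q \<in> carrier (poly_ring X) \<Longrightarrow> p * q \<in> carrier (poly_ring X)"
proof -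
  assume p: "p \<in> carrier (poly_ring X)" and q: "q \<in> carrier (poly_ring X)"
  show "p + q \<in> carrier (poly_ring X)"
    using p q keys_add[of p q] by (fastforce simp: poly_ring_carrier)
  show "p * q \<in> carrier (poly_ring X)"
    unfolding poly_ring_carrier
  proof
    fix k assume "k \<in> Poly_Mapping.keys (p * q)"
    then obtain a b where "a \<in> Poly_Mapping.keys p" "b \<in> Poly_Mapping.keys q" "k = a + b"
      using keys_mult[of p q] by blast
    then show "Poly_Mapping.keys k \<subseteq> X"
      using p q keys_add[of a b] unfolding poly_ring_carrier by blast
  qed
qed (auto simp: poly_ring_carrier Const_def Var_def)

lemma poly_ring_cring: "cring (poly_ring X :: ('x, 'k::comm_ring_1) mpoly ring)"
proof (rule cringI)
  show "abelian_group (poly_ring X :: ('x, 'k) mpoly ring)"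
  proof (rule abelian_groupI)
    fix p :: "('x, 'k) mpoly" assume "p \<in> carrier (poly_ring X)"
    then show "\<exists>q\<in>carrier (poly_ring X). q \<oplus>\<^bsub>poly_ring X\<^esub> p = \<zero>\<^bsub>poly_ring X\<^esub>"
      by (intro bexI[of _ "- p"]) (simp_all add: poly_ring_closed)
  qed (simp_all add: poly_ring_closed add_ac)
  show "comm_monoid (poly_ring X :: ('x, 'k) mpoly ring)"
    by (rule comm_monoidI) (simp_all add: poly_ring_closed mult_ac)
qed (simp add: ring_distribs)


section \<open>Toric ideals of graphs\<close>

text \<open>
  Edges and vertices themselves serve as the variables: for an edge \<open>e = {u, v}\<close> with
  \<open>u \<noteq> v\<close>, the product below is \<open>Var u * Var v\<close>.
\<close>

definition toric_map :: "('v set, 'k::comm_ring_1) mpoly \<Rightarrow> ('v, 'k) mpoly" where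
  "toric_map = poly_subst Const (\<lambda>e. \<Prod>v\<in>e. Var v)"

definition toric_ideal :: "'v set \<Rightarrow> 'v set set \<Rightarrow> ('v set, 'k::comm_ring_1) mpoly set" where
  "toric_ideal V E = a_kernel (poly_ring E) (poly_ring V) toric_map"

definition extended_ideal :: "'x set \<Rightarrow> ('x, 'k::comm_ring_1) mpoly set \<Rightarrow> ('x, 'k) mpoly set" where
  "extended_ideal X I = genideal (poly_ring X) I"

lemma toric_map_simps:
  "toric_map (p + q) = toric_map p + toric_map q"
  "toric_map (p * q) = toric_map p * toric_map q"
  "toric_map (Const a) = Const a"
  "toric_map (Var e) = (\<Prod>v\<in>e. Var v)"
  by (simp_all add: toric_map_def poly_subst_add poly_subst_mult poly_subst_single
        Const_def Var_def single_add mult_single)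

lemma toric_map_ring_hom:
  assumes "finite_simple_graph V E"
  shows "(toric_map :: ('v set, 'k::comm_ring_1) mpoly \<Rightarrow> _) \<in> ring_hom (poly_ring E) (poly_ring V)"
proof (rule ring_hom_memI)
  have sum: "(\<Sum>i\<in>A. f i) \<in> carrier (poly_ring V)"
    if "\<And>i. i \<in> A \<Longrightarrow> f i \<in> carrier (poly_ring V)"
    for A :: "'i set" and f :: "'i \<Rightarrow> ('v, 'k) mpoly"
    using that by (induction A rule: infinite_finite_induct) (simp_all add: poly_ring_closed)
  have prod: "(\<Prod>i\<in>A. f i) \<in> carrier (poly_ring V)"
    if "\<And>i. i \<in> A \<Longrightarrow> f i \<in> carrier (poly_ring V)"
    for A :: "'i set" and f :: "'i \<Rightarrow> ('v, 'k) mpoly"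
    using that by (induction A rule: infinite_finite_induct) (simp_all add: poly_ring_closed)
  have power: "f ^ n \<in> carrier (poly_ring V)" if "f \<in> carrier (poly_ring V)"
    for f :: "('v, 'k) mpoly" and n :: nat
    using that by (induction n) (simp_all add: poly_ring_closed)
  fix p :: "('v set, 'k) mpoly" assume p: "p \<in> carrier (poly_ring E)"
  have "v \<in> V" if "m \<in> Poly_Mapping.keys p" "e \<in> Poly_Mapping.keys m" "v \<in> e" for m e v
  proof -
    have "e \<in> E" using p that unfolding poly_ring_carrier by blast
    then show ?thesis using assms that(3) unfolding finite_simple_graph_def by blast
  qed
  then show "toric_map p \<in> carrier (poly_ring V)"
    unfolding toric_map_def poly_subst_def
    by (intro sum poly_ring_closed prod power) blast
next
  show "toric_map \<one>\<^bsub>poly_ring E\<^esub> = (\<one>\<^bsub>poly_ring V\<^esub> :: ('v, 'k) mpoly)"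
    using toric_map_simps(3)[of "1 :: 'k"] by (simp add: Const_def)
qed (simp_all add: toric_map_simps)


section \<open>Projective space and projective varieties\<close>

text \<open>
  Homogeneous coordinates are indexed by a finite set \<open>X\<close> (the variables), so that the
  projective space has dimension \<open>card X - 1\<close> and is empty for \<open>X = {}\<close>. A point is the class
  of a nonzero coordinate vector under nonzero scaling.
\<close>

definition nonzero_vectors :: "'x set \<Rightarrow> ('x \<Rightarrow> 'k::field) set" where
  "nonzero_vectors X = {a \<in> X \<rightarrow>\<^sub>E UNIV. \<exists>x\<in>X. a x \<noteq> 0}"

definition proj_rel :: "'x set \<Rightarrow> (('x \<Rightarrow> 'k::field) \<times> ('x \<Rightarrow> 'k)) set" where
  "proj_rel X = {(a, b). a \<in> nonzero_vectors X \<and> b \<in> nonzero_vectors X \<and>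
                   (\<exists>c. c \<noteq> 0 \<and> (\<forall>x\<in>X. b x = c * a x))}"

definition proj_space :: "'x set \<Rightarrow> ('x \<Rightarrow> 'k::field) set set" where
  "proj_space X = nonzero_vectors X // proj_rel X"

definition proj_point :: "'x set \<Rightarrow> ('x \<Rightarrow> 'k::field) \<Rightarrow> ('x \<Rightarrow> 'k) set" where
  "proj_point X a = proj_rel X `` {a}"

lemma equiv_proj_rel: "equiv (nonzero_vectors X) (proj_rel X)"
proof (rule equivI)
  show "proj_rel X \<subseteq> nonzero_vectors X \<times> nonzero_vectors X"
    by (auto simp: proj_rel_def)
  show "refl_on (nonzero_vectors X) (proj_rel X)"
    by (auto simp: refl_on_def proj_rel_def intro: exI[of _ 1])
  show "sym (proj_rel X)"
  proof (rule symI)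
    fix a b assume "(a, b) \<in> proj_rel X"
    then obtain c where c: "a \<in> nonzero_vectors X" "b \<in> nonzero_vectors X" "c \<noteq> 0"
      "\<forall>x\<in>X. b x = c * a x" unfolding proj_rel_def by blast
    then have "\<forall>x\<in>X. a x = inverse c * b x" by simp
    with c show "(b, a) \<in> proj_rel X"
      unfolding proj_rel_def using nonzero_imp_inverse_nonzero by blast
  qed
  show "trans (proj_rel X)"
  proof (rule transI)
    fix a b d assume "(a, b) \<in> proj_rel X" "(b, d) \<in> proj_rel X"
    then obtain r s where "a \<in> nonzero_vectors X" "d \<in> nonzero_vectors X" "r \<noteq> 0" "s \<noteq> 0"
      "\<forall>x\<in>X. b x = r * a x" "\<forall>x\<in>X. d x = s * b x" unfolding proj_rel_def by blast
    then show "(a, d) \<in> proj_rel X"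
      by (auto simp: proj_rel_def intro!: exI[of _ "s * r"])
  qed
qed

text \<open>
  As usual, only the homogeneous elements of the ideal are evaluated; for these, vanishing does
  not depend on the representative of the point.
\<close>

definition proj_variety :: "'x set \<Rightarrow> ('x, 'k::field) mpoly set \<Rightarrow> ('x \<Rightarrow> 'k) set set" where
  "proj_variety X I =
     {P \<in> proj_space X. \<forall>f\<in>I. homogeneous f \<longrightarrow> (\<forall>a\<in>P. poly_subst id a f = 0)}"

definition zariski_closed :: "'x set \<Rightarrow> ('x \<Rightarrow> 'k::field) set set \<Rightarrow> bool" where
  "zariski_closed X Z \<longleftrightarrow> (\<exists>J. homogeneous_ideal X J \<and> Z = proj_variety X J)"

text \<open>\<open>zariski_closed X hull S\<close> is the intersection of all Zariski closed sets containing \<open>S\<close>.\<close>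

definition hadamard_product ::
  "'x set \<Rightarrow> ('x \<Rightarrow> 'k::field) set set \<Rightarrow> ('x \<Rightarrow> 'k) set set \<Rightarrow> ('x \<Rightarrow> 'k) set set" where
  "hadamard_product X A B =
     zariski_closed X hull
       {proj_point X (\<lambda>x\<in>X. a x * b x) | a b P Q.
          P \<in> A \<and> Q \<in> B \<and> a \<in> P \<and> b \<in> Q \<and> (\<exists>x\<in>X. a x * b x \<noteq> 0)}"

end

theory Submission
  imports Defs
begin

text \<open>
  The toric ideal of a graph is controlled by the binomials \<open>x\<^sup>m - x\<^sup>n\<close> whose two monomials have the
  same image under the toric map: a point on which these binomials vanish is a zero of the whole
  ideal, because in an element of the ideal the coefficients over each image monomial sum to zero.
  The binomials of \<open>H\<close> are also binomials of \<open>G\<close>, and the condition \<open>p\<^sup>m = p\<^sup>n\<close> is multiplicative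
  in \<open>p\<close>; hence the product of a point of the variety of \<open>G\<close> with one of the variety of \<open>H\<close> lies
  in the latter, which is closed since the binomials are homogeneous. Conversely, the all-ones
  point lies in the variety of \<open>G\<close> and is neutral for the Hadamard product.
\<close>

section \<open>Evaluation of monomials and polynomials at a point\<close>

definition monom_eval :: "('x \<Rightarrow> 'k::comm_ring_1) \<Rightarrow> ('x \<Rightarrow>\<^sub>0 nat) \<Rightarrow> 'k" where
  "monom_eval a m = (\<Prod>x\<in>Poly_Mapping.keys m. a x ^ Poly_Mapping.lookup m x)"

definition mpoly_eval :: "('x \<Rightarrow> 'k::comm_ring_1) \<Rightarrow> ('x, 'k) mpoly \<Rightarrow> 'k" where
  "mpoly_eval = poly_subst id"

lemma monom_eval_mult: "monom_eval (\<lambda>x. a x * b x) m = monom_eval a m * monom_eval b m"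
  by (simp add: monom_eval_def power_mult_distrib prod.distrib)

lemma monom_eval_const: "monom_eval (\<lambda>_. c) m = c ^ mono_degree m"
  by (simp add: monom_eval_def mono_degree_def power_sum)

lemma monom_eval_cong:
  assumes "Poly_Mapping.keys m \<subseteq> X" "\<And>x. x \<in> X \<Longrightarrow> a x = b x"
  shows "monom_eval a m = monom_eval b m"
  unfolding monom_eval_def by (rule prod.cong) (use assms in auto)

lemma mpoly_eval_eq:
  "mpoly_eval a p = (\<Sum>m\<in>Poly_Mapping.keys p. Poly_Mapping.lookup p m * monom_eval a m)"
  by (simp add: mpoly_eval_def poly_subst_def monom_eval_def)

lemma mpoly_eval_simps [simp]:
  "mpoly_eval a (0 :: ('x, 'k::comm_ring_1) mpoly) = 0"
  "mpoly_eval a (1 :: ('x, 'k::comm_ring_1) mpoly) = 1"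
  "mpoly_eval a (p + q) = mpoly_eval a p + mpoly_eval a q"
  "mpoly_eval a (p * q) = mpoly_eval a p * mpoly_eval a q"
  "mpoly_eval a (Poly_Mapping.single m c) = c * monom_eval a m"
  by (simp_all add: mpoly_eval_def poly_subst_def[of _ _ 0] poly_subst_add poly_subst_mult
      poly_subst_single monom_eval_def flip: single_one)

lemma mpoly_eval_uminus [simp]: "mpoly_eval a (- p) = - mpoly_eval a p"
  using mpoly_eval_simps(3)[of a p "- p"] by (simp add: eq_neg_iff_add_eq_0 add.commute)

lemma mpoly_eval_diff [simp]:
  "mpoly_eval a (p - q) = mpoly_eval a p - mpoly_eval a q"
  using mpoly_eval_simps(3)[of a p "- q"] by simp

lemma mpoly_eval_prod [simp]:
  "mpoly_eval a (\<Prod>i\<in>A. f i) = (\<Prod>i\<in>A. mpoly_eval a (f i))"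
  by (induction A rule: infinite_finite_induct) simp_all

lemma mpoly_eval_power [simp]: "mpoly_eval a (p ^ n) = mpoly_eval a p ^ n"
  by (induction n) simp_all

lemma mpoly_eval_Var [simp]: "mpoly_eval a (Var x) = a x"
  by (simp add: Var_def monom_eval_def)

lemma mpoly_eval_Const [simp]: "mpoly_eval a (Const c) = c"
  by (simp add: Const_def monom_eval_def)

text \<open>Both sides are algebra homomorphisms that agree on each variable \<open>Var e\<close>.
  This is the monomial parametrisation of the toric variety by vertex weights
  \<open>w\<close>.\<close>

lemma mpoly_eval_toric_map:
  "mpoly_eval w (toric_map p) = mpoly_eval (\<lambda>e. \<Prod>v\<in>e. w v) p"
proof (induction p rule: mpoly_induct)
  case (1 m a)
  show ?case
    by (simp add: toric_map_def poly_subst_single Const_def[of 0]) (simp add: monom_eval_def)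
qed (simp add: toric_map_simps)

text \<open>Monomials with coefficient 1 are closed under products and contain the image of every
  edge variable.\<close>

lemma toric_map_single:
  "\<exists>n. toric_map (Poly_Mapping.single m (1::'k::comm_ring_1)) = Poly_Mapping.single n 1"
proof -
  define M :: "(('a \<Rightarrow>\<^sub>0 nat) \<Rightarrow>\<^sub>0 'k) set" where "M = range (\<lambda>n. Poly_Mapping.single n 1)"
  have one: "1 \<in> M" unfolding M_def by (metis single_one rangeI)
  have mult: "p * q \<in> M" if "p \<in> M" "q \<in> M" for p q
    using that unfolding M_def by (auto simp: mult_single)
  have prod: "(\<Prod>i\<in>A. f i) \<in> M" if "\<And>i. i \<in> A \<Longrightarrow> f i \<in> M" for A :: "'i set" and f
    using that by (induction A rule: infinite_finite_induct) (auto simp: one mult)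
  have pow: "p ^ n \<in> M" if "p \<in> M" for p n
    using that by (induction n) (auto simp: one mult)
  have var: "Var v \<in> M" for v by (simp add: M_def Var_def)
  have "toric_map (Poly_Mapping.single m (1::'k)) \<in> M"
    by (simp add: toric_map_def poly_subst_single Const_def prod pow var)
  then show ?thesis by (auto simp: M_def)
qed

section \<open>Points satisfying the binomial equations\<close>

text \<open>The exponents do not mention the coefficient ring, so it is passed as a type
  argument.\<close>

definition toric_equiv :: "'k::comm_ring_1 itself \<Rightarrow> ('v set \<Rightarrow>\<^sub>0 nat) \<Rightarrow> ('v set \<Rightarrow>\<^sub>0 nat) \<Rightarrow> bool" where
  "toric_equiv _ m n \<longleftrightarrow>
     toric_map (Poly_Mapping.single m (1::'k)) = toric_map (Poly_Mapping.single n 1)"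

text \<open>The equations of the affine cone over the toric variety. Zero coordinates are allowed,
  so boundary points outside the torus are included.\<close>

definition toric_point :: "'v set set \<Rightarrow> ('v set \<Rightarrow> 'k::comm_ring_1) \<Rightarrow> bool" where
  "toric_point E a \<longleftrightarrow>
     (\<forall>m n. Poly_Mapping.keys m \<subseteq> E \<longrightarrow> Poly_Mapping.keys n \<subseteq> E \<longrightarrow>
        toric_equiv TYPE('k) m n \<longrightarrow> monom_eval a m = monom_eval a n)"

lemma toric_pointD:
  fixes a :: "'v set \<Rightarrow> 'k::comm_ring_1"
  assumes "toric_point E a" "Poly_Mapping.keys m \<subseteq> E" "Poly_Mapping.keys n \<subseteq> E"
    and "toric_equiv TYPE('k) m n"
  shows "monom_eval a m = monom_eval a n"
  using assms unfolding toric_point_def by blast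

lemma toric_point_mono: "toric_point E a \<Longrightarrow> E1 \<subseteq> E \<Longrightarrow> toric_point E1 a"
  unfolding toric_point_def by blast

lemma toric_point_mult:
  "toric_point E a \<Longrightarrow> toric_point E b \<Longrightarrow> toric_point E (\<lambda>x. a x * b x)"
  unfolding toric_point_def monom_eval_mult by metis

lemma toric_point_cong:
  assumes "\<And>x. x \<in> E \<Longrightarrow> a x = b x"
  shows "toric_point E a \<longleftrightarrow> toric_point E b"
  unfolding toric_point_def using monom_eval_cong[of _ E a b] assms by auto

lemma toric_point_zero:
  fixes a :: "'v set \<Rightarrow> 'k::comm_ring_1"
  assumes "toric_point E a" "p \<in> toric_ideal V E"
  shows "mpoly_eval a p = 0"
proof -
  have p: "p \<in> carrier (poly_ring E)" and p0: "toric_map p = 0"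
    using assms(2) by (auto simp: toric_ideal_def a_kernel_def' )
  obtain \<phi> where \<phi>: "\<And>m :: 'v set \<Rightarrow>\<^sub>0 nat.
      toric_map (Poly_Mapping.single m (1::'k)) = Poly_Mapping.single (\<phi> m) 1"
    using toric_map_single by metis
  let ?K = "Poly_Mapping.keys p"
  let ?c = "Poly_Mapping.lookup p"
  have "toric_map p = (\<Sum>m\<in>?K. Const (?c m) * toric_map (Poly_Mapping.single m (1::'k)))"
    by (simp add: toric_map_def poly_subst_def[of _ _ p] poly_subst_single Const_def)
  also have "\<dots> = (\<Sum>m\<in>?K. Poly_Mapping.single (\<phi> m) (?c m))"
    by (simp add: \<phi> Const_def mult_single)
  finally have sum0: "(\<Sum>m\<in>?K. Poly_Mapping.single (\<phi> m) (?c m)) = 0" using p0 by simp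
  \<comment> \<open>The coefficient of \<open>toric_map p\<close> at the monomial \<open>n\<close>:
    \<open>\<phi>\<close> need not be injective, so it collects all terms of \<open>p\<close> lying
    over \<open>n\<close>.\<close>
  have fibre: "(\<Sum>m\<in>{m\<in>?K. \<phi> m = n}. ?c m) = 0" for n
  proof -
    have "0 = Poly_Mapping.lookup (\<Sum>m\<in>?K. Poly_Mapping.single (\<phi> m) (?c m)) n"
      by (simp add: sum0)
    also have "\<dots> = (\<Sum>m\<in>?K. if \<phi> m = n then ?c m else 0)"
      by (simp add: lookup_sum lookup_single when_def)
    also have "\<dots> = (\<Sum>m\<in>{m\<in>?K. \<phi> m = n}. ?c m)"
      by (rule sum.mono_neutral_cong_right) auto
    finally show ?thesis by simp
  qed
  have "mpoly_eval a p =
      (\<Sum>n\<in>\<phi> ` ?K. \<Sum>m\<in>{m\<in>?K. \<phi> m = n}. ?c m * monom_eval a m)"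
    unfolding mpoly_eval_eq by (rule sum.image_gen) simp
  also have "\<dots> = 0"
  proof (rule sum.neutral, rule ballI)
    fix n assume "n \<in> \<phi> ` ?K"
    \<comment> \<open>\<open>m0\<close> is any monomial of the fibre. All others take the same value
      at \<open>a\<close>, so this value factors out and leaves the zero sum of
      coefficients.\<close>
    then obtain m0 where m0: "m0 \<in> ?K" "n = \<phi> m0" by blast
    have "(\<Sum>m\<in>{m\<in>?K. \<phi> m = n}. ?c m * monom_eval a m) =
        (\<Sum>m\<in>{m\<in>?K. \<phi> m = n}. ?c m * monom_eval a m0)"
    proof (rule sum.cong[OF refl])
      fix m assume m: "m \<in> {m\<in>?K. \<phi> m = n}"
      then have "toric_equiv TYPE('k) m m0" using m0 by (simp add: toric_equiv_def \<phi>)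
      then show "?c m * monom_eval a m = ?c m * monom_eval a m0"
        using toric_pointD[OF assms(1), of m m0] p m m0 by (simp add: poly_ring_carrier)
    qed
    also have "\<dots> = 0" by (simp add: fibre flip: sum_distrib_right)
    finally show "(\<Sum>m\<in>{m\<in>?K. \<phi> m = n}. ?c m * monom_eval a m) = 0" .
  qed
  finally show ?thesis .
qed

text \<open>By minimality of the generated ideal, this reduces vanishing on an ideal to vanishing on
  its generators.\<close>

lemma vanishing_ideal: "ideal {p \<in> carrier (poly_ring X). mpoly_eval a p = 0} (poly_ring X)"
proof -
  interpret cring "poly_ring X" by (rule poly_ring_cring)
  have inv: "\<ominus>\<^bsub>poly_ring X\<^esub> p = - p" if "p \<in> carrier (poly_ring X)" for p
    using that by (intro minus_equality) (simp_all add: poly_ring_closed)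
  show ?thesis
  proof (rule idealI)
    show "subgroup {p \<in> carrier (poly_ring X). mpoly_eval a p = 0} (add_monoid (poly_ring X))"
      by (rule add.subgroupI)
        (auto simp: poly_ring_closed inv simp flip: a_inv_def intro!: exI[of _ 0])
  qed (auto simp: poly_ring_closed ring_axioms)
qed

lemma toric_point_extended_zero:
  assumes "toric_point E1 a" "E1 \<subseteq> E" "p \<in> extended_ideal E (toric_ideal V E1)"
  shows "mpoly_eval a p = 0"
proof -
  have "toric_ideal V E1 \<subseteq> {p \<in> carrier (poly_ring E). mpoly_eval a p = 0}"
    using assms toric_point_zero[OF assms(1)]
    by (fastforce simp: toric_ideal_def a_kernel_def' poly_ring_carrier)
  then show ?thesis
    using ring.genideal_minimal[OF cring.axioms(1)[OF poly_ring_cring] vanishing_ideal] assms(3)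
    unfolding extended_ideal_def by blast
qed

text \<open>Giving every vertex the value 2 gives every edge the value 4, since an edge has exactly
  two vertices. The common image then yields equal powers of 4.\<close>

lemma toric_equiv_mono_degree:
  fixes E :: "'v set set"
  assumes "finite_simple_graph V E" "toric_equiv TYPE('k::field_char_0) m n"
    and "Poly_Mapping.keys m \<subseteq> E" "Poly_Mapping.keys n \<subseteq> E"
  shows "mono_degree m = mono_degree n"
proof -
  have four: "(\<Prod>v\<in>e. 2) = (4::'k)" if "e \<in> E" for e
    using assms(1) that by (auto simp: finite_simple_graph_def)
  have ev: "mpoly_eval (\<lambda>_. 2::'k) (toric_map (Poly_Mapping.single l 1)) = 4 ^ mono_degree l"
    if "Poly_Mapping.keys l \<subseteq> E" for l
    using monom_eval_cong[OF that four]
    by (simp add: mpoly_eval_toric_map monom_eval_const)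
  have "(4::'k) ^ mono_degree m = 4 ^ mono_degree n"
    using ev[OF assms(3)] ev[OF assms(4)] assms(2) unfolding toric_equiv_def by simp
  \<comment> \<open>Characteristic zero lets the equation of powers be read in the natural numbers,
    where the exponent is determined.\<close>
  then have "of_nat (4 ^ mono_degree m) = (of_nat (4 ^ mono_degree n) :: 'k)" by simp
  then have "(4::nat) ^ mono_degree m = 4 ^ mono_degree n" unfolding of_nat_eq_iff .
  then show ?thesis by simp
qed

text \<open>Classically these span the toric ideal; below it suffices that they have the same common
  zeros.\<close>

definition toric_binomials :: "'v set set \<Rightarrow> ('v set, 'k::comm_ring_1) mpoly set" where
  "toric_binomials E = {Poly_Mapping.single m 1 - Poly_Mapping.single n 1 | m n.
     Poly_Mapping.keys m \<subseteq> E \<and> Poly_Mapping.keys n \<subseteq> E \<and> toric_equiv TYPE('k) m n}"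

lemma toric_binomials_eval:
  fixes a :: "'a set \<Rightarrow> 'b::comm_ring_1"
  shows "toric_point E a \<longleftrightarrow> (\<forall>p\<in>toric_binomials E. mpoly_eval a p = 0)"
proof -
  have "toric_point E a \<longleftrightarrow> (\<forall>m n. Poly_Mapping.keys m \<subseteq> E \<longrightarrow> Poly_Mapping.keys n \<subseteq> E \<longrightarrow>
      toric_equiv TYPE('b) m n \<longrightarrow>
      mpoly_eval a (Poly_Mapping.single m 1 - Poly_Mapping.single n 1) = 0)"
    by (simp add: toric_point_def)
  then show ?thesis unfolding toric_binomials_def by blast
qed

lemma toric_binomials_subset_toric_ideal:
  fixes E :: "'v set set"
  shows "toric_binomials E \<subseteq> toric_ideal V E"
proof
  fix p :: "('v set, 'k::comm_ring_1) mpoly" assume "p \<in> toric_binomials E"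
  then obtain m n where p: "p = Poly_Mapping.single m 1 - Poly_Mapping.single n 1"
    and mn: "Poly_Mapping.keys m \<subseteq> E" "Poly_Mapping.keys n \<subseteq> E" "toric_equiv TYPE('k) m n"
    unfolding toric_binomials_def by blast
  have "toric_map p + toric_map (Poly_Mapping.single n 1) = toric_map (Poly_Mapping.single m (1::'k))"
    by (simp add: p flip: toric_map_simps(1))
  then have "toric_map p = 0" using mn(3) by (simp add: toric_equiv_def)
  moreover have "p \<in> carrier (poly_ring E)"
    unfolding p diff_conv_add_uminus
    by (intro poly_ring_closed(5,6)) (use mn in \<open>auto simp: poly_ring_carrier\<close>)
  ultimately show "p \<in> toric_ideal V E" by (simp add: toric_ideal_def a_kernel_def')
qed

lemma toric_binomials_homogeneous:
  fixes E :: "'v set set"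
  assumes "finite_simple_graph V E" "p \<in> (toric_binomials E :: ('v set, 'k::field_char_0) mpoly set)"
  shows "homogeneous p"
proof -
  obtain m n where p: "p = Poly_Mapping.single m 1 - Poly_Mapping.single n 1"
    and mn: "Poly_Mapping.keys m \<subseteq> E" "Poly_Mapping.keys n \<subseteq> E" "toric_equiv TYPE('k) m n"
    using assms(2) unfolding toric_binomials_def by blast
  \<comment> \<open>Only an inclusion, since the two terms cancel when \<open>m = n\<close>.\<close>
  have "Poly_Mapping.keys p \<subseteq> {m, n}"
    unfolding p by (auto simp: in_keys_iff lookup_minus lookup_single when_def split: if_splits)
  then show ?thesis
    unfolding homogeneous_def
    using toric_equiv_mono_degree[OF assms(1) mn(3,1,2)] by (auto intro!: exI[of _ "mono_degree m"])
qed

section \<open>Projective varieties cut out by the binomials\<close>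

lemma carrier_poly_ring_mono: "X \<subseteq> Y \<Longrightarrow> carrier (poly_ring X) \<subseteq> carrier (poly_ring Y)"
  by (fastforce simp: poly_ring_carrier)

lemma toric_ideal_subset_carrier: "toric_ideal V E \<subseteq> carrier (poly_ring E)"
  by (auto simp: toric_ideal_def a_kernel_def')

lemma subset_genideal:
  "S \<subseteq> carrier (poly_ring X) \<Longrightarrow> S \<subseteq> genideal (poly_ring X) S"
  by (rule ring.genideal_self[OF cring.axioms(1)[OF poly_ring_cring]])

text \<open>The binomials are homogeneous elements of \<open>I\<close>, so zeros of \<open>I\<close>
  are toric points; the last assumption gives the converse. It serves the toric ideal, its extension
  and the ideal generated by the binomials alike.\<close>

lemma proj_variety_between:
  fixes I :: "('v set, 'k::field_char_0) mpoly set"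
  assumes "finite_simple_graph V1 E1" "toric_binomials E1 \<subseteq> I"
    and "\<And>p a. p \<in> I \<Longrightarrow> toric_point E1 a \<Longrightarrow> mpoly_eval a p = 0"
  shows "proj_variety E I = {P \<in> proj_space E. \<forall>a\<in>P. toric_point E1 a}"
proof -
  have "(\<forall>f\<in>I. homogeneous f \<longrightarrow> (\<forall>a\<in>P. mpoly_eval a f = 0)) \<longleftrightarrow> (\<forall>a\<in>P. toric_point E1 a)" for P
    using assms(2,3) toric_binomials_homogeneous[OF assms(1)]
    unfolding toric_binomials_eval by (meson subsetD)
  then show ?thesis by (simp add: proj_variety_def flip: mpoly_eval_def)
qed

lemma proj_variety_toric:
  assumes "finite_simple_graph V E"
  shows "proj_variety E (toric_ideal V E :: ('v set, 'k::field_char_0) mpoly set) =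
    {P \<in> proj_space E. \<forall>a\<in>P. toric_point E a}"
  using assms toric_binomials_subset_toric_ideal toric_point_zero by (rule proj_variety_between)

lemma proj_variety_extended:
  assumes "finite_simple_graph V1 E1" "E1 \<subseteq> E"
  shows "proj_variety E (extended_ideal E (toric_ideal V1 E1 :: ('v set, 'k::field_char_0) mpoly set)) =
    {P \<in> proj_space E. \<forall>a\<in>P. toric_point E1 a}"
proof (rule proj_variety_between[OF assms(1)])
  show "toric_binomials E1 \<subseteq>
      extended_ideal E (toric_ideal V1 E1 :: ('v set, 'k) mpoly set)"
    unfolding extended_ideal_def
    by (meson order_trans toric_binomials_subset_toric_ideal subset_genideal
        toric_ideal_subset_carrier carrier_poly_ring_mono assms(2))
qed (rule toric_point_extended_zero[OF _ assms(2)])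

text \<open>Closedness asks for an ideal with homogeneous generators. The ideal generated by the
  binomials has them by construction and defines the same variety, so homogeneity of the extended
  ideal itself need not be shown.\<close>

lemma zariski_closed_extended:
  assumes "finite_simple_graph V1 E1" "E1 \<subseteq> E"
  shows "zariski_closed E
    (proj_variety E (extended_ideal E (toric_ideal V1 E1 :: ('v set, 'k::field_char_0) mpoly set)))"
proof -
  let ?B = "toric_binomials E1 :: ('v set, 'k) mpoly set"
  let ?J = "genideal (poly_ring E) ?B"
  have B: "?B \<subseteq> carrier (poly_ring E)"
    by (meson order_trans toric_binomials_subset_toric_ideal toric_ideal_subset_carrier
        carrier_poly_ring_mono assms(2))
  have "proj_variety E ?J = {P \<in> proj_space E. \<forall>a\<in>P. toric_point E1 a}"
  proof (rule proj_variety_between[OF assms(1) subset_genideal[OF B]])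
    fix p and a :: "'v set \<Rightarrow> 'k" assume p: "p \<in> ?J" and a: "toric_point E1 a"
    have "?B \<subseteq> {p \<in> carrier (poly_ring E). mpoly_eval a p = 0}"
      using B a toric_binomials_eval by blast
    then show "mpoly_eval a p = 0"
      using ring.genideal_minimal[OF cring.axioms(1)[OF poly_ring_cring] vanishing_ideal] p by blast
  qed
  moreover have "homogeneous_ideal E ?J"
    unfolding homogeneous_ideal_def using B toric_binomials_homogeneous[OF assms(1)] by blast
  ultimately show ?thesis
    unfolding zariski_closed_def proj_variety_extended[OF assms] by (intro exI[of _ ?J]) simp
qed

section \<open>Rescaling and representatives of projective points\<close>

text \<open>The constant vector \<open>c\<close> is itself a toric point, because equivalent
  monomials have equal degree; scaling is multiplication by it.\<close>

lemma toric_point_scale: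
  fixes a :: "'v set \<Rightarrow> 'k::field_char_0"
  assumes "finite_simple_graph V E" "toric_point E a"
  shows "toric_point E (\<lambda>x. c * a x)"
proof (rule toric_point_mult[OF _ assms(2)])
  show "toric_point E (\<lambda>_. c)"
    using toric_equiv_mono_degree[OF assms(1), where 'k = 'k]
    by (fastforce simp: toric_point_def monom_eval_const)
qed

lemma toric_point_one: "toric_point E (\<lambda>_. 1)"
  by (simp add: toric_point_def monom_eval_const)

lemma proj_point_in_space: "a \<in> nonzero_vectors X \<Longrightarrow> proj_point X a \<in> proj_space X"
  unfolding proj_point_def proj_space_def by (rule quotientI)

lemma proj_space_eq_proj_point:
  assumes "P \<in> proj_space X" "a \<in> P"
  shows "P = proj_point X a" "a \<in> nonzero_vectors X"
proof -
  obtain b where b: "b \<in> nonzero_vectors X" "P = proj_rel X `` {b}"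
    using assms(1) unfolding proj_space_def by (blast elim: quotientE)
  then show "P = proj_point X a"
    using assms(2) equiv_class_eq[OF equiv_proj_rel, of b a] by (auto simp: proj_point_def)
  show "a \<in> nonzero_vectors X" using assms(2) b by (auto simp: proj_rel_def)
qed

text \<open>Lets the equations be checked on a single representative of a projective point.\<close>

lemma proj_point_toric:
  fixes a :: "'v set \<Rightarrow> 'k::field_char_0"
  assumes "finite_simple_graph V E1" "E1 \<subseteq> E" "toric_point E1 a" "b \<in> proj_point E a"
  shows "toric_point E1 b"
proof -
  obtain c where "\<forall>x\<in>E. b x = c * a x"
    using assms(4) by (auto simp: proj_point_def proj_rel_def)
  then show ?thesis
    using toric_point_scale[OF assms(1,3), of c] assms(2)
      toric_point_cong[of E1 b "\<lambda>x. c * a x"] by blast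
qed

theorem theorem1p2:
  fixes V V1 :: "'v set" and E E1 :: "'v set set"
    and I_G I_H :: "('v set, 'k::{alg_closed_field, field_char_0}) mpoly set"
  assumes G: "finite_simple_graph V E"
    and H: "subgraph_of V1 E1 V E"
    and I_G: "I_G = toric_ideal V E"
    and I_H: "I_H = toric_ideal V1 E1"
  shows "hadamard_product E (proj_variety E I_G) (proj_variety E (extended_ideal E I_H)) =
         proj_variety E (extended_ideal E I_H)"
proof -
  have H1: "finite_simple_graph V1 E1" and sub: "E1 \<subseteq> E"
    using H by (auto simp: subgraph_of_def)
  let ?ZG = "proj_variety E I_G" and ?ZH = "proj_variety E (extended_ideal E I_H)"
  let ?S = "{proj_point E (\<lambda>x\<in>E. a x * b x) | a b P Q.
      P \<in> ?ZG \<and> Q \<in> ?ZH \<and> a \<in> P \<and> b \<in> Q \<and> (\<exists>x\<in>E. a x * b x \<noteq> 0)}"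
  have ZG: "?ZG = {P \<in> proj_space E. \<forall>a\<in>P. toric_point E a}"
    unfolding I_G by (rule proj_variety_toric[OF G])
  have ZH: "?ZH = {P \<in> proj_space E. \<forall>a\<in>P. toric_point E1 a}"
    unfolding I_H by (rule proj_variety_extended[OF H1 sub])
  have "?S \<subseteq> ?ZH"
  proof clarify
    fix a b P Q x
    assume P: "P \<in> ?ZG" "a \<in> P" and Q: "Q \<in> ?ZH" "b \<in> Q" and x: "x \<in> E" "a x * b x \<noteq> 0"
    let ?r = "\<lambda>x\<in>E. a x * b x"
    have "toric_point E1 (\<lambda>x. a x * b x)"
      using P Q sub unfolding ZG ZH by (auto intro: toric_point_mult toric_point_mono)
    \<comment> \<open>Restriction to \<open>E\<close> changes only coordinates outside
      \<open>E\<close>, which no monomial in the edges \<open>E1\<close> involves.\<close>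
    then have r: "toric_point E1 ?r"
      using toric_point_cong[of E1 ?r "\<lambda>x. a x * b x"] sub by (auto simp: subset_iff)
    have "?r \<in> nonzero_vectors E" using x by (auto simp: nonzero_vectors_def)
    then show "proj_point E ?r \<in> ?ZH"
      unfolding ZH using proj_point_in_space proj_point_toric[OF H1 sub r] by blast
  qed
  moreover have "?ZH \<subseteq> ?S"
  proof
    fix Q assume Q: "Q \<in> ?ZH"
    then have Qs: "Q \<in> proj_space E" by (simp add: ZH)
    then obtain b where b: "b \<in> Q"
      unfolding proj_space_def using in_quotient_imp_non_empty[OF equiv_proj_rel] by blast
    note bQ = proj_space_eq_proj_point[OF Qs b]
    let ?u = "\<lambda>x\<in>E. 1 :: 'k"
    \<comment> \<open>A nonzero coordinate of \<open>b\<close> provides an edge; this makes the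
      all-ones vector \<open>?u\<close> nonzero.\<close>
    obtain x where x: "x \<in> E" "b x \<noteq> 0" using bQ(2) by (auto simp: nonzero_vectors_def)
    have u: "?u \<in> nonzero_vectors E" using x by (auto simp: nonzero_vectors_def)
    have "toric_point E ?u"
      using toric_point_one toric_point_cong[of E ?u "\<lambda>_. 1"] by auto
    then have uG: "proj_point E ?u \<in> ?ZG"
      unfolding ZG using proj_point_in_space[OF u] proj_point_toric[OF G subset_refl] by blast
    have "?u \<in> proj_point E ?u"
      unfolding proj_point_def by (rule equiv_class_self[OF equiv_proj_rel u])
    \<comment> \<open>Equality of functions, not only on \<open>E\<close>: both sides are
      \<open>undefined\<close> outside \<open>E\<close>.\<close>
    moreover have "(\<lambda>x\<in>E. ?u x * b x) = b"
      using bQ(2) by (auto simp: nonzero_vectors_def PiE_def extensional_def fun_eq_iff)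
    then have "Q = proj_point E (\<lambda>x\<in>E. ?u x * b x)" using bQ(1) by simp
    moreover have "\<exists>x\<in>E. ?u x * b x \<noteq> 0" using x by auto
    ultimately show "Q \<in> ?S"
      using uG Q b by (intro CollectI exI[of _ ?u] exI[of _ b] exI[of _ "proj_point E ?u"] exI[of _ Q] conjI)
  qed
  ultimately have "?S = ?ZH" by (rule subset_antisym)
  \<comment> \<open>The set of products already equals a closed set, so taking its closure adds
    nothing.\<close>
  moreover have "zariski_closed E ?ZH" unfolding I_H by (rule zariski_closed_extended[OF H1 sub])
  ultimately show ?thesis unfolding hadamard_product_def by (metis hull_same)
qed

end
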